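(* There is a universal constant $C_0>0$ such that the following holds. Let $n,M\ge1$, let $P_1,\dots,P_M,Q_1,\dots,Q_M\in\{I,X,Y,Z\}^{\otimes n}$ be Pauli operators such that $[P_i\otimes Q_i,P_j\otimes Q_j]=0$ for all pairs $(i,j)$, and let $\epsilon\in(0,1)$, $\delta\in(0,1/2]$. Then there is an algorithm which, for every Hermitian operator $O$ on $n$ qubits with $\mathrm{tr}(O^2)=2^n$ and every $n$-qubit unitary $U$, with $O(t)=U^\dagger OU$, simultaneously estimates the $M$ out-of-time-ordered correlators $\left\{\mathrm{tr}(O(t)P_iO(t)Q_i)/2^n\right\}_{i=1}^M$ to additive error $\epsilon$ with success probability at least $1-\delta$ (i.e. with probability at least $1-\delta$ all $M$ estimates are within $\epsilon$ of the true values), using at most $C_0\log(M/\delta)/\epsilon^2$ samples of $|O(t)\rangle\rangle_{\mathcal C}$, measured in a common eigenbasis of $\{P_i\otimes Q_i\}_{i=1}^M$.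
   Context: For an operator $X\neq0$ on $n$ qubits, its vectorization in the computational operator basis $\mathcal C=\{|i\rangle\langle j|\}$ is the $2n$-qubit unit vector $|X\rangle\rangle_{\mathcal C}=\frac{1}{\sqrt{\mathrm{tr}(X^\dagger X)}}\sum_{i,j}\langle i|X|j\rangle\,|i\rangle\otimes|j\rangle\in\mathcal H_L\otimes\mathcal H_R$, with $\mathcal H_L,\mathcal H_R\cong(\mathbb C^2)^{\otimes n}$. In $P\otimes Q$, $P$ acts on $\mathcal H_L$ and $Q$ on $\mathcal H_R$. Each sample is an independent copy of the state, measured projectively in an orthonormal basis of common eigenvectors of all $P_i\otimes Q_i$. An "algorithm" is a classical post-processing of the measurement outcomes which may depend on $n,M,\epsilon,\delta$ and the $P_i,Q_i$, but has no access to $O,U$ other than through the outcomes. *)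

theory Defs
  imports "HOL-Probability.Probability" "Jordan_Normal_Form.Schur_Decomposition"
begin

unbundle no vec_syntax
unbundle no inner_syntax
hide_const (open) Finite_Cartesian_Product.vec Finite_Cartesian_Product.mat
  Finite_Cartesian_Product.row Finite_Cartesian_Product.column

text \<open>Operators on \<open>n\<close> qubits are complex matrices in \<open>carrier_mat (2 ^ n) (2 ^ n)\<close>.\<close>

definition mat_trace :: "complex mat \<Rightarrow> complex" where
  "mat_trace A = (\<Sum>i<dim_row A. A $$ (i, i))"

definition hermitian :: "complex mat \<Rightarrow> bool" where
  "hermitian A \<longleftrightarrow> mat_adjoint A = A"

definition unitary :: "nat \<Rightarrow> complex mat \<Rightarrow> bool" where
  "unitary d U \<longleftrightarrow> U \<in> carrier_mat d d \<and>
     mat_adjoint U * U = 1\<^sub>m d \<and> U * mat_adjoint U = 1\<^sub>m d"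

text \<open>The product basis vector \<open>|i\<rangle> \<otimes> |j\<rangle>\<close> has index \<open>i * d + j\<close>, where \<open>d\<close> is the dimension of
  the right factor.\<close>

definition kron :: "complex mat \<Rightarrow> complex mat \<Rightarrow> complex mat" where
  "kron A B = mat (dim_row A * dim_row B) (dim_col A * dim_col B)
     (\<lambda>(r, c). A $$ (r div dim_row B, c div dim_col B) * B $$ (r mod dim_row B, c mod dim_col B))"

definition pauli_I :: "complex mat" where
  "pauli_I = mat_of_rows_list 2 [[1, 0], [0, 1]]"

definition pauli_X :: "complex mat" where
  "pauli_X = mat_of_rows_list 2 [[0, 1], [1, 0]]"

definition pauli_Y :: "complex mat" where
  "pauli_Y = mat_of_rows_list 2 [[0, - \<i>], [\<i>, 0]]"

definition pauli_Z :: "complex mat" where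
  "pauli_Z = mat_of_rows_list 2 [[1, 0], [0, - 1]]"

definition pauli_ops :: "nat \<Rightarrow> complex mat set" where
  "pauli_ops n = {foldr kron ps (1\<^sub>m 1) | ps.
     length ps = n \<and> set ps \<subseteq> {pauli_I, pauli_X, pauli_Y, pauli_Z}}"

definition vectorize :: "complex mat \<Rightarrow> complex vec" where
  "vectorize X = vec (dim_row X * dim_col X)
     (\<lambda>k. X $$ (k div dim_col X, k mod dim_col X)
          / complex_of_real (sqrt (Re (mat_trace (mat_adjoint X * X)))))"

definition orthonormal_basis :: "nat \<Rightarrow> (nat \<Rightarrow> complex vec) \<Rightarrow> bool" where
  "orthonormal_basis d b \<longleftrightarrow> (\<forall>k<d. b k \<in> carrier_vec d) \<and>
     (\<forall>k<d. \<forall>l<d. b k \<bullet>c b l = (if k = l then 1 else 0))"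

definition common_eigenbasis ::
  "nat \<Rightarrow> complex mat set \<Rightarrow> (nat \<Rightarrow> complex vec) \<Rightarrow> bool" where
  "common_eigenbasis d S b \<longleftrightarrow> orthonormal_basis d b \<and>
     (\<forall>A\<in>S. \<forall>k<d. \<exists>ev. eigenvector A (b k) ev)"

text \<open>Outcome distribution (Born rule) of the projective measurement of \<open>\<psi>\<close> in the basis
  \<open>b 0, \<dots>, b (d - 1)\<close>; the outcome is the index of the basis vector. \<^const>\<open>embed_pmf\<close> is
  meaningful only for weights summing to 1: see \<open>pmf_basis_measurement\<close> below.\<close>

definition basis_measurement ::
  "nat \<Rightarrow> (nat \<Rightarrow> complex vec) \<Rightarrow> complex vec \<Rightarrow> nat pmf" where
  "basis_measurement d b \<psi> = embed_pmf (\<lambda>k. if k < d then (cmod (\<psi> \<bullet>c b k))\<^sup>2 else 0)"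

definition heisenberg :: "complex mat \<Rightarrow> complex mat \<Rightarrow> complex mat" where
  "heisenberg U H = mat_adjoint U * H * U"

definition otoc :: "nat \<Rightarrow> complex mat \<Rightarrow> complex mat \<Rightarrow> complex mat \<Rightarrow> complex" where
  "otoc n A P Q = mat_trace (A * P * A * Q) / 2 ^ n"

lemma dim_mat_adjoint [simp]:
  "dim_row (mat_adjoint A) = dim_col A" "dim_col (mat_adjoint A) = dim_row A"
  by (simp_all add: mat_adjoint_def)

lemma mat_adjoint_index:
  fixes A :: "complex mat"
  assumes "i < dim_col A" "j < dim_row A"
  shows "mat_adjoint A $$ (i, j) = cnj (A $$ (j, i))"
  using assms by (simp add: mat_adjoint_def mat_of_rows_index)

lemma cscalar_prod_sum:
  fixes v w :: "complex vec"
  shows "v \<bullet>c w = (\<Sum>i<dim_vec w. v $ i * cnj (w $ i))"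
  by (simp add: scalar_prod_def atLeast0LessThan)

lemma orthonormal_basis_complete:
  assumes b: "orthonormal_basis d b" and "i < d" "j < d"
  shows "(\<Sum>k<d. b k $ i * cnj (b k $ j)) = (if i = j then 1 else 0)"
proof -
  define A where "A = mat d d (\<lambda>(i, k). b k $ i)"
  have dim: "A \<in> carrier_mat d d" "mat_adjoint A \<in> carrier_mat d d"
    unfolding carrier_mat_def by (simp_all add: A_def)
  have "mat_adjoint A * A = 1\<^sub>m d"
  proof (rule eq_matI)
    fix k l assume kl: "k < dim_row (1\<^sub>m d :: complex mat)" "l < dim_col (1\<^sub>m d :: complex mat)"
    then have "k < d" "l < d"
      by simp_all
    then have "b l \<bullet>c b k = (if l = k then 1 else 0)" and "b k \<in> carrier_vec d"
      using b unfolding orthonormal_basis_def by blast+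
    then have "(\<Sum>i<d. b l $ i * cnj (b k $ i)) = (if l = k then 1 else 0)"
      unfolding cscalar_prod_sum by (simp only: carrier_vecD)
    moreover have "(mat_adjoint A * A) $$ (k, l) = (\<Sum>i<d. cnj (b k $ i) * b l $ i)"
      using \<open>k < d\<close> \<open>l < d\<close> by (simp add: scalar_prod_def mat_adjoint_index A_def atLeast0LessThan)
    ultimately show "(mat_adjoint A * A) $$ (k, l) = 1\<^sub>m d $$ (k, l)"
      using \<open>k < d\<close> \<open>l < d\<close> by (auto simp: mult.commute)
  qed (auto simp: A_def)
  then have "A * mat_adjoint A = 1\<^sub>m d"
    using mat_mult_left_right_inverse[OF dim(2) dim(1)] by simp
  then have "(A * mat_adjoint A) $$ (i, j) = (if i = j then 1 else 0)"
    using assms by simp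
  then show ?thesis
    using assms by (simp add: scalar_prod_def mat_adjoint_index A_def atLeast0LessThan)
qed

lemma orthonormal_basis_parseval:
  assumes b: "orthonormal_basis d b" and psi: "\<psi> \<in> carrier_vec d"
  shows "(\<Sum>k<d. (cmod (\<psi> \<bullet>c b k))\<^sup>2) = Re (\<psi> \<bullet>c \<psi>)"
proof -
  have "complex_of_real (\<Sum>k<d. (cmod (\<psi> \<bullet>c b k))\<^sup>2)
      = (\<Sum>k<d. (\<Sum>i<d. \<psi> $ i * cnj (b k $ i)) * cnj (\<Sum>j<d. \<psi> $ j * cnj (b k $ j)))"
    using b by (auto simp: complex_norm_square cscalar_prod_sum orthonormal_basis_def intro!: sum.cong simp del: of_real_power)
  also have "\<dots> = (\<Sum>k<d. \<Sum>i<d. \<Sum>j<d. \<psi> $ i * cnj (\<psi> $ j) * (b k $ j * cnj (b k $ i)))"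
    by (simp add: sum_product mult_ac)
  also have "\<dots> = (\<Sum>i<d. \<Sum>j<d. \<Sum>k<d. \<psi> $ i * cnj (\<psi> $ j) * (b k $ j * cnj (b k $ i)))"
    by (subst sum.swap, intro sum.cong refl sum.swap)
  also have "\<dots> = (\<Sum>i<d. \<Sum>j<d. \<psi> $ i * cnj (\<psi> $ j) * (\<Sum>k<d. b k $ j * cnj (b k $ i)))"
    by (simp add: sum_distrib_left)
  also have "\<dots> = (\<Sum>i<d. \<Sum>j<d. if j = i then \<psi> $ i * cnj (\<psi> $ j) else 0)"
    by (intro sum.cong refl) (auto simp: orthonormal_basis_complete[OF b])
  also have "\<dots> = \<psi> \<bullet>c \<psi>"
    using psi by (simp add: cscalar_prod_sum)
  finally show ?thesis
    by (metis Re_complex_of_real)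
qed

lemma pmf_basis_measurement:
  assumes b: "orthonormal_basis d b" and psi: "\<psi> \<in> carrier_vec d" "\<psi> \<bullet>c \<psi> = 1"
  shows "pmf (basis_measurement d b \<psi>) k = (if k < d then (cmod (\<psi> \<bullet>c b k))\<^sup>2 else 0)"
proof -
  let ?f = "\<lambda>k. if k < d then (cmod (\<psi> \<bullet>c b k))\<^sup>2 else 0"
  have "(\<integral>\<^sup>+k. ennreal (?f k) \<partial>count_space UNIV) = (\<Sum>k<d. ennreal (?f k))"
    by (rule nn_integral_count_space'[of "{..<d}"]) auto
  also have "\<dots> = ennreal (\<Sum>k<d. (cmod (\<psi> \<bullet>c b k))\<^sup>2)"
    by (subst sum_ennreal) auto
  also have "\<dots> = 1"
    using orthonormal_basis_parseval[OF b psi(1)] psi(2) by simp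
  finally show ?thesis
    unfolding basis_measurement_def by (subst pmf_embed_pmf) auto
qed

lemma vectorize_unit:
  assumes X: "X \<in> carrier_mat d d" and "X \<noteq> 0\<^sub>m d d"
  shows "vectorize X \<in> carrier_vec (d * d)" "vectorize X \<bullet>c vectorize X = 1"
proof -
  define s where "s = (\<Sum>i<d. \<Sum>j<d. (cmod (X $$ (i, j)))\<^sup>2)"
  have tr: "mat_trace (mat_adjoint X * X) = complex_of_real s"
  proof -
    have "mat_trace (mat_adjoint X * X) = (\<Sum>j<d. \<Sum>i<d. cnj (X $$ (i, j)) * X $$ (i, j))"
      using X by (auto simp: mat_trace_def scalar_prod_def mat_adjoint_index atLeast0LessThan intro!: sum.cong)
    also have "\<dots> = complex_of_real s"
      unfolding s_def by (subst sum.swap) (simp add: complex_norm_square mult.commute del: of_real_power)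
    finally show ?thesis .
  qed
  obtain i0 j0 where ij: "i0 < d" "j0 < d" "X $$ (i0, j0) \<noteq> 0"
    using assms by (metis carrier_matD eq_matI index_zero_mat)
  have "(cmod (X $$ (i0, j0)))\<^sup>2 \<le> (\<Sum>j<d. (cmod (X $$ (i0, j)))\<^sup>2)"
    using ij by (intro member_le_sum) auto
  also have "\<dots> \<le> s"
    unfolding s_def using ij by (intro member_le_sum[of i0 _ "\<lambda>i. \<Sum>j<d. (cmod (X $$ (i, j)))\<^sup>2"]) (auto intro: sum_nonneg)
  finally have s: "s > 0"
    using ij(3) by (smt (verit) zero_less_norm_iff zero_less_power)
  show "vectorize X \<in> carrier_vec (d * d)"
    using X by (simp add: vectorize_def)
  have "vectorize X \<bullet>c vectorize X
      = (\<Sum>k<d * d. complex_of_real ((cmod (X $$ (k div d, k mod d)))\<^sup>2 / s))"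
    using X s unfolding cscalar_prod_sum
    by (auto simp: vectorize_def tr complex_norm_square field_simps simp flip: of_real_mult simp del: of_real_power intro!: sum.cong)
  also have "\<dots> = complex_of_real ((\<Sum>k<d * d. (cmod (X $$ (k div d, k mod d)))\<^sup>2) / s)"
    by (simp add: sum_divide_distrib)
  also have "(\<Sum>k<d * d. (cmod (X $$ (k div d, k mod d)))\<^sup>2)
      = (\<Sum>(i, j)\<in>{..<d} \<times> {..<d}. (cmod (X $$ (i, j)))\<^sup>2)"
  proof (rule sum.reindex_bij_witness[of _ "\<lambda>(i, j). i * d + j" "\<lambda>k. (k div d, k mod d)"])
    fix p assume "p \<in> {..<d} \<times> {..<d}"
    then obtain i j where p: "p = (i, j)" "i < d" "j < d"
      by auto
    then have "i * d + j < Suc i * d" and "Suc i * d \<le> d * d"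
      by (simp, intro mult_le_mono1, simp)
    then show "(case p of (i, j) \<Rightarrow> i * d + j) \<in> {..<d * d}"
      using p by simp
  qed (use ij(1) in \<open>auto simp: less_mult_imp_div_less\<close>)
  also have "\<dots> = s"
    by (simp add: s_def sum.cartesian_product)
  finally show "vectorize X \<bullet>c vectorize X = 1"
    using s by simp
qed

end

theory Submission
  imports Defs
begin

text \<open>For Hermitian \<open>X = O(t)\<close> the row-major vectorization gives
  \<open>\<langle>\<langle>X| P \<otimes> Q |X\<rangle>\<rangle> = tr (X P X Q\<^sup>T) / 2 ^ n\<close>, and \<open>Q\<^sup>T = \<plusminus> Q\<close> with a sign that depends only on the Pauli
  string \<open>Q\<close>. So every correlator is, up to a known sign, the expectation of a \<open>\<plusminus> 1\<close>-valued function of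
  the outcome of a measurement in any common eigenbasis, and the same samples serve all \<open>M\<close>
  empirical means: by Hoeffding's inequality and a union bound, \<open>\<lceil>2 ln (2 M / \<delta>) / \<epsilon>\<^sup>2\<rceil>\<close> samples suffice.\<close>

section \<open>Empirical means of independent samples\<close>

text \<open>Independence in product form: the first draw factors out of the integral, and induction
  handles the rest. With \<open>h\<close> an exponential, this makes the moment generating function
  of a sum of samples an \<open>N\<close>-th power.\<close>

lemma nn_integral_replicate_pmf_prod:
  fixes h :: "'a \<Rightarrow> ennreal"
  shows "(\<integral>\<^sup>+xs. prod_list (map h xs) \<partial>measure_pmf (replicate_pmf N p)) = (\<integral>\<^sup>+x. h x \<partial>measure_pmf p) ^ N"
  by (induction N) (simp_all add: nn_integral_cmult nn_integral_multc)

text \<open>Chernoff's method: bound the exponential moment of the centred sum by the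
  \<open>N\<close>-th power of the one-sample bound from Hoeffding's lemma, then apply Markov's
  inequality to the exponential.\<close>

lemma replicate_pmf_Hoeffding_ge:
  fixes f :: "'a \<Rightarrow> real"
  assumes f: "\<And>x. x \<in> set_pmf p \<Longrightarrow> f x \<in> {a..b}" and "a < b" "\<epsilon> > 0"
  shows "measure_pmf.prob (replicate_pmf N p)
      {xs. sum_list (map f xs) \<ge> real N * (measure_pmf.expectation p f + \<epsilon>)}
    \<le> exp (- (2 * real N * \<epsilon>\<^sup>2) / (b - a)\<^sup>2)"
proof -
  define \<mu> where "\<mu> = measure_pmf.expectation p f"
  \<comment> \<open>This \<open>l\<close> minimises the exponent per sample, l^2 (b - a)^2 / 8 - l
    \<epsilon>; the minimum is -2 \<epsilon>^2 / (b - a)^2.\<close>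
  define l where "l = 4 * \<epsilon> / (b - a)\<^sup>2"
  have l: "l > 0" using assms by (simp add: l_def)
  interpret interval_bounded_random_variable "measure_pmf p" f a b
    by unfold_locales (use f in \<open>auto simp: AE_measure_pmf_iff\<close>)
  have len: "AE xs in measure_pmf (replicate_pmf N p). length xs = N"
    by (simp add: AE_measure_pmf_iff set_replicate_pmf)
  have "(\<integral>\<^sup>+xs. ennreal (exp (l * (sum_list (map f xs) - real N * \<mu>))) \<partial>measure_pmf (replicate_pmf N p))
      = (\<integral>\<^sup>+xs. prod_list (map (\<lambda>x. ennreal (exp (l * (f x - \<mu>)))) xs) \<partial>measure_pmf (replicate_pmf N p))"
  proof (rule nn_integral_cong_AE, rule eventually_mono[OF len])
    fix xs :: "'a list"
    \<comment> \<open>With \<open>length xs\<close> in place of \<open>N\<close> the factorization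
      holds for every list, so induction on \<open>xs\<close> applies; almost every sample has
      length \<open>N\<close>.\<close>
    have "ennreal (exp (l * (sum_list (map f xs) - real (length xs) * \<mu>)))
        = prod_list (map (\<lambda>x. ennreal (exp (l * (f x - \<mu>)))) xs)"
    proof (induction xs)
      case (Cons x xs)
      have "l * (sum_list (map f (x # xs)) - real (length (x # xs)) * \<mu>)
          = l * (f x - \<mu>) + l * (sum_list (map f xs) - real (length xs) * \<mu>)"
        by (simp add: algebra_simps)
      then show ?case
        by (simp only: exp_add ennreal_mult exp_ge_zero Cons.IH list.map prod_list.Cons)
    qed simp
    then show "length xs = N \<Longrightarrow> ennreal (exp (l * (sum_list (map f xs) - real N * \<mu>)))
        = prod_list (map (\<lambda>x. ennreal (exp (l * (f x - \<mu>)))) xs)" by simp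
  qed
  also have "\<dots> = (\<integral>\<^sup>+x. ennreal (exp (l * (f x - \<mu>))) \<partial>measure_pmf p) ^ N"
    by (rule nn_integral_replicate_pmf_prod)
  also have "\<dots> \<le> ennreal (exp (l\<^sup>2 * (b - a)\<^sup>2 / 8)) ^ N"
    using Hoeffdings_lemma_nn_integral[OF l] by (intro power_mono) (simp_all add: \<mu>_def)
  also have "\<dots> = ennreal (exp (real N * (l\<^sup>2 * (b - a)\<^sup>2 / 8)))"
    by (simp add: ennreal_power flip: exp_of_nat_mult)
  finally have mgf: "(\<integral>\<^sup>+xs. ennreal (exp (l * (sum_list (map f xs) - real N * \<mu>))) \<partial>measure_pmf (replicate_pmf N p))
    \<le> ennreal (exp (real N * (l\<^sup>2 * (b - a)\<^sup>2 / 8)))" .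
  have "emeasure (measure_pmf (replicate_pmf N p)) {xs. sum_list (map f xs) - real N * \<mu> \<ge> real N * \<epsilon>}
    \<le> ennreal (exp (- l * (real N * \<epsilon>))) * (\<integral>\<^sup>+xs. ennreal (exp (l * (sum_list (map f xs) - real N * \<mu>))) \<partial>measure_pmf (replicate_pmf N p))"
    using Chernoff_ineq_nn_integral_ge[OF l, where A = UNIV and a = "real N * \<epsilon>"
        and f = "\<lambda>xs. sum_list (map f xs) - real N * \<mu>" and M = "measure_pmf (replicate_pmf N p)"]
    by simp
  also have "\<dots> \<le> ennreal (exp (- l * (real N * \<epsilon>))) * ennreal (exp (real N * (l\<^sup>2 * (b - a)\<^sup>2 / 8)))"
    by (intro mult_left_mono mgf) simp
  also have "\<dots> = ennreal (exp (real N * (l\<^sup>2 * (b - a)\<^sup>2 / 8) - l * (real N * \<epsilon>)))"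
    by (simp flip: ennreal_mult exp_add)
  also have "real N * (l\<^sup>2 * (b - a)\<^sup>2 / 8) - l * (real N * \<epsilon>) = - (2 * real N * \<epsilon>\<^sup>2) / (b - a)\<^sup>2"
  proof -
    \<comment> \<open>The algebra depends on \<open>b - a\<close> only through its being nonzero, so
      it is done for a generic \<open>w\<close>.\<close>
    have "real N * ((4 * \<epsilon> / w\<^sup>2)\<^sup>2 * w\<^sup>2 / 8) - 4 * \<epsilon> / w\<^sup>2 * (real N * \<epsilon>)
        = - (2 * real N * \<epsilon>\<^sup>2) / w\<^sup>2" if "w \<noteq> 0" for w
      using that by (simp add: field_simps power2_eq_square)
    then show ?thesis using \<open>a < b\<close> by (simp add: l_def)
  qed
  finally show ?thesis
    by (simp add: measure_pmf.emeasure_eq_measure \<mu>_def algebra_simps)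
qed


text \<open>Apply the one-sided bound to \<open>f\<close> and to \<open>- f\<close>, whose values
  lie in \<open>{- b..- a}\<close>, an interval of the same width. The deviation is strict so that
  the complementary event reads \<le> \<epsilon>.\<close>

lemma replicate_pmf_Hoeffding_abs:
  fixes f :: "'a \<Rightarrow> real"
  assumes f: "\<And>x. x \<in> set_pmf p \<Longrightarrow> f x \<in> {a..b}" and "a < b" "\<epsilon> > 0" "N > 0"
  shows "measure_pmf.prob (replicate_pmf N p)
      {xs. \<bar>sum_list (map f xs) / N - measure_pmf.expectation p f\<bar> > \<epsilon>}
    \<le> 2 * exp (- (2 * real N * \<epsilon>\<^sup>2) / (b - a)\<^sup>2)"
proof -
  let ?\<mu> = "measure_pmf.expectation p f"
  let ?Q = "measure_pmf.prob (replicate_pmf N p)"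
  let ?A = "{xs. sum_list (map f xs) \<ge> real N * (?\<mu> + \<epsilon>)}"
  let ?B = "{xs. sum_list (map (\<lambda>x. - f x) xs) \<ge> real N * (measure_pmf.expectation p (\<lambda>x. - f x) + \<epsilon>)}"
  have "{xs. \<bar>sum_list (map f xs) / N - ?\<mu>\<bar> > \<epsilon>} \<subseteq> ?A \<union> ?B"
    using \<open>N > 0\<close> by (auto simp: abs_if field_simps uminus_sum_list_map[unfolded o_def, symmetric] split: if_splits)
  then have "?Q {xs. \<bar>sum_list (map f xs) / N - ?\<mu>\<bar> > \<epsilon>} \<le> ?Q (?A \<union> ?B)"
    by (intro measure_pmf.finite_measure_mono) auto
  also have "\<dots> \<le> ?Q ?A + ?Q ?B"
    by (intro measure_Un_le) auto
  also have "?Q ?A \<le> exp (- (2 * real N * \<epsilon>\<^sup>2) / (b - a)\<^sup>2)"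
    using assms by (intro replicate_pmf_Hoeffding_ge) auto
  also have "?Q ?B \<le> exp (- (2 * real N * \<epsilon>\<^sup>2) / (- a - (- b))\<^sup>2)"
    using assms by (intro replicate_pmf_Hoeffding_ge) auto
  finally show ?thesis by simp
qed

text \<open>The union bound tolerates any dependence between the events, so all \<open>M\<close>
  empirical means can be computed from one list of samples. Each failure probability is at most
  \<delta> / M.\<close>

lemma replicate_pmf_simultaneous_means:
  fixes f :: "nat \<Rightarrow> 'a \<Rightarrow> real" and M N :: nat
  assumes f: "\<And>i x. i < M \<Longrightarrow> x \<in> set_pmf p \<Longrightarrow> \<bar>f i x\<bar> \<le> 1" 
    and "\<epsilon> > 0" "N > 0" "M > 0" "\<delta> > 0" and N: "real N \<ge> 2 * ln (2 * M / \<delta>) / \<epsilon>\<^sup>2"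
  shows "measure_pmf.prob (replicate_pmf N p)
      {xs. \<forall>i<M. \<bar>sum_list (map (f i) xs) / N - measure_pmf.expectation p (f i)\<bar> \<le> \<epsilon>} \<ge> 1 - \<delta>"
proof -
  let ?Q = "measure_pmf.prob (replicate_pmf N p)"
  let ?B = "\<lambda>i. {xs. \<bar>sum_list (map (f i) xs) / N - measure_pmf.expectation p (f i)\<bar> > \<epsilon>}"
  \<comment> \<open>The values lie in an interval of width 2, so the Hoeffding exponent is -N
    \<epsilon>^2 / 2; the assumption on \<open>N\<close> is rearranged to match it.\<close>
  have "ln (2 * M / \<delta>) \<le> real N * \<epsilon>\<^sup>2 / 2"
    using N \<open>\<epsilon> > 0\<close> by (simp add: field_simps)
  then have "exp (ln (2 * M / \<delta>)) \<le> exp (real N * \<epsilon>\<^sup>2 / 2)"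
    by simp
  also have "exp (ln (2 * M / \<delta>)) = 2 * M / \<delta>"
    using assms by simp
  finally have "2 * M / \<delta> \<le> exp (real N * \<epsilon>\<^sup>2 / 2)" .
  then have bound: "M * (2 * exp (- (real N * \<epsilon>\<^sup>2 / 2))) \<le> \<delta>"
    using \<open>\<delta> > 0\<close> by (simp add: exp_minus field_simps)
  have "?Q (\<Union>i<M. ?B i) \<le> (\<Sum>i<M. ?Q (?B i))"
    by (intro measure_pmf.finite_measure_subadditive_finite) auto
  also have "\<dots> \<le> (\<Sum>i<M. 2 * exp (- (2 * real N * \<epsilon>\<^sup>2) / (1 - (-1))\<^sup>2))"
    using assms by (intro sum_mono replicate_pmf_Hoeffding_abs) (auto simp: abs_le_iff)
  also have "\<dots> \<le> \<delta>"
    using bound by simp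
  finally have "1 - \<delta> \<le> 1 - ?Q (\<Union>i<M. ?B i)" by simp
  also have "\<dots> = ?Q (UNIV - (\<Union>i<M. ?B i))"
    using measure_pmf.prob_compl[of "\<Union>i<M. ?B i" "replicate_pmf N p"] by simp
  also have "UNIV - (\<Union>i<M. ?B i) = {xs. \<forall>i<M. \<bar>sum_list (map (f i) xs) / N - measure_pmf.expectation p (f i)\<bar> \<le> \<epsilon>}"
    by (auto simp: not_less)
  finally show ?thesis .
qed

text \<open>As \<delta> \<le> 1/2 forces M / \<delta> \<ge> 2, the quantity ln (M / \<delta>) is
  bounded away from zero and absorbs both the summand ln 2 and the rounding up to an
  integer.\<close>

lemma sample_size:
  fixes M :: nat and \<epsilon> \<delta> :: real
  assumes "M \<ge> 1" "0 < \<epsilon>" "\<epsilon> < 1" "0 < \<delta>" "\<delta> \<le> 1 / 2"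
  obtains N :: nat where "N > 0" "real N \<ge> 2 * ln (2 * M / \<delta>) / \<epsilon>\<^sup>2"
    "real N \<le> 6 * ln (M / \<delta>) / \<epsilon>\<^sup>2"
proof
  have ge: "M / \<delta> \<ge> 2"
    using assms by (simp add: field_simps)
  then have ln2: "ln 2 \<le> ln (M / \<delta>)" by simp
  have "ln (2 * M / \<delta>) = ln 2 + ln (M / \<delta>)"
    using assms ln_mult[of 2 "M / \<delta>"] by simp
  with ln2 have le: "ln (2 * M / \<delta>) \<le> 2 * ln (M / \<delta>)" by simp
  have "ln (M / \<delta>) \<ge> 1 / 2"
    using ln2 ln2_ge_two_thirds by simp
  have pos: "2 * ln (2 * M / \<delta>) / \<epsilon>\<^sup>2 > 0"
    using assms by (intro divide_pos_pos mult_pos_pos ln_gt_zero) (auto simp: field_simps)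
  let ?N = "nat \<lceil>2 * ln (2 * M / \<delta>) / \<epsilon>\<^sup>2\<rceil>"
  show "?N > 0" "real ?N \<ge> 2 * ln (2 * M / \<delta>) / \<epsilon>\<^sup>2"
    using pos by linarith+
  have "real ?N \<le> 2 * ln (2 * M / \<delta>) / \<epsilon>\<^sup>2 + 1"
    using pos by linarith
  \<comment> \<open>The 6 splits as 4 + 2: doubling the logarithm gives 4, and the 1 lost to the
    ceiling costs at most 2, since ln (M / \<delta>) \<ge> 1/2 and \<epsilon>^2 \<le> 1.\<close>
  also have "\<dots> \<le> (4 * ln (M / \<delta>)) / \<epsilon>\<^sup>2 + (2 * ln (M / \<delta>)) / \<epsilon>\<^sup>2"
  proof (intro add_mono divide_right_mono)
    have "\<epsilon>\<^sup>2 \<le> 1" using assms by (simp add: power_le_one)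
    then show "1 \<le> 2 * ln (M / \<delta>) / \<epsilon>\<^sup>2"
      using assms \<open>ln (M / \<delta>) \<ge> 1 / 2\<close> by (simp add: le_divide_eq)
  qed (use le in auto)
  finally show "real ?N \<le> 6 * ln (M / \<delta>) / \<epsilon>\<^sup>2"
    by (simp add: add_divide_distrib[symmetric])
qed

section \<open>Kronecker products and Pauli operators\<close>

text \<open>The composite index \<open>k = i * b + j\<close> is the row-major convention shared by
  \<open>kron\<close> and \<open>vectorize\<close>; this splits sums over it into double
  sums.\<close>

lemma sum_div_mod:
  fixes f :: "nat \<Rightarrow> nat \<Rightarrow> 'a :: comm_monoid_add"
  shows "(\<Sum>k<a * b. f (k div b) (k mod b)) = (\<Sum>i<a. \<Sum>j<b. f i j)"
proof -
  have "(\<Sum>k<a * b. f (k div b) (k mod b)) = (\<Sum>(i, j)\<in>{..<a} \<times> {..<b}. f i j)"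
  proof (rule sum.reindex_bij_witness[of _ "\<lambda>(i, j). i * b + j" "\<lambda>k. (k div b, k mod b)"])
    fix p assume "p \<in> {..<a} \<times> {..<b}"
    then obtain i j where p: "p = (i, j)" "i < a" "j < b"
      by auto
    then have "i * b + j < Suc i * b" and "Suc i * b \<le> a * b"
      by (simp, intro mult_le_mono1, simp)
    then show "(case p of (i, j) \<Rightarrow> i * b + j) \<in> {..<a * b}"
      using p by simp
  next
    fix k assume "k \<in> {..<a * b}"
    then have "k < a * b" "b > 0" by (auto intro: gr0I)
    then show "(k div b, k mod b) \<in> {..<a} \<times> {..<b}"
      by (simp add: less_mult_imp_div_less)
  qed auto
  then show ?thesis by (simp add: sum.cartesian_product)
qed

section \<open>Entrywise formulas for products, traces and adjoints\<close>

lemma index_mult_mat_sum: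
  assumes "A \<in> carrier_mat m n" "B \<in> carrier_mat n p" "i < m" "j < p"
  shows "(A * B) $$ (i, j) = (\<Sum>k<n. A $$ (i, k) * B $$ (k, j))"
  using assms by (auto simp: scalar_prod_def atLeast0LessThan intro!: sum.cong)

lemma index_mult_mat_vec_sum:
  assumes "A \<in> carrier_mat m n" "v \<in> carrier_vec n" "i < m"
  shows "(A *\<^sub>v v) $ i = (\<Sum>k<n. A $$ (i, k) * v $ k)"
  using assms by (auto simp: scalar_prod_def atLeast0LessThan intro!: sum.cong)

lemma mat_trace_mult:
  assumes "A \<in> carrier_mat m n" "B \<in> carrier_mat n m"
  shows "mat_trace (A * B) = (\<Sum>i<m. \<Sum>k<n. A $$ (i, k) * B $$ (k, i))"
  using assms by (auto simp: mat_trace_def scalar_prod_def atLeast0LessThan intro!: sum.cong)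

lemma mat_trace_comm:
  assumes "A \<in> carrier_mat m n" "B \<in> carrier_mat n m"
  shows "mat_trace (A * B) = mat_trace (B * A)"
  unfolding mat_trace_mult[OF assms] mat_trace_mult[OF assms(2,1)]
  by (subst sum.swap) (simp add: mult.commute)

lemma mat_adjoint_carrier [intro]:
  "A \<in> carrier_mat m n \<Longrightarrow> mat_adjoint A \<in> carrier_mat n m"
  by (auto intro: carrier_matI)

lemma mat_adjoint_mat_adjoint:
  fixes A :: "complex mat"
  shows "mat_adjoint (mat_adjoint A) = A"
  by (rule eq_matI) (simp_all add: mat_adjoint_index)

lemma mat_adjoint_mult:
  fixes A B :: "complex mat"
  assumes "A \<in> carrier_mat m n" "B \<in> carrier_mat n p"
  shows "mat_adjoint (A * B) = mat_adjoint B * mat_adjoint A"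
  using assms
  by (intro eq_matI)
     (auto simp: mat_adjoint_index scalar_prod_def mult.commute intro!: sum.cong)

lemma cscalar_prod_mult_mat_vec:
  fixes A :: "complex mat"
  assumes "A \<in> carrier_mat m n" "v \<in> carrier_vec n" "w \<in> carrier_vec m"
  shows "(A *\<^sub>v v) \<bullet>c w = v \<bullet>c (mat_adjoint A *\<^sub>v w)"
proof -
  have "(A *\<^sub>v v) \<bullet>c w = (\<Sum>i<m. \<Sum>k<n. A $$ (i, k) * v $ k * cnj (w $ i))"
    using assms by (auto simp: cscalar_prod_sum index_mult_mat_vec_sum[OF assms(1,2)] sum_distrib_right
        simp del: index_mult_mat_vec intro!: sum.cong)
  also have "\<dots> = (\<Sum>k<n. v $ k * cnj (\<Sum>i<m. mat_adjoint A $$ (k, i) * w $ i))"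
    using assms by (subst sum.swap) (auto simp: sum_distrib_left mat_adjoint_index intro!: sum.cong)
  also have "\<dots> = v \<bullet>c (mat_adjoint A *\<^sub>v w)"
    using assms by (auto simp: cscalar_prod_sum
        index_mult_mat_vec_sum[OF mat_adjoint_carrier[OF assms(1)] assms(3)]
        simp del: index_mult_mat_vec intro!: sum.cong)
  finally show ?thesis .
qed

section \<open>Algebra of the Kronecker product\<close>

lemma kron_carrier [intro]:
  "A \<in> carrier_mat a b \<Longrightarrow> B \<in> carrier_mat c d \<Longrightarrow> kron A B \<in> carrier_mat (a * c) (b * d)"
  by (auto simp: kron_def)

lemma kron_index:
  assumes "A \<in> carrier_mat a b" "B \<in> carrier_mat c d" "i < a * c" "j < b * d"
  shows "kron A B $$ (i, j) = A $$ (i div c, j div d) * B $$ (i mod c, j mod d)"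
  using assms by (simp add: kron_def)

lemma div_mod_less:
  fixes i :: nat
  assumes "i < a * c"
  shows "i div c < a" "i mod c < c"
  using assms by (auto simp: less_mult_imp_div_less intro!: mod_less_divisor gr0I)

text \<open>The mixed-product rule: splitting the summation index by \<open>sum_div_mod\<close>
  leaves a product of two independent sums, one per tensor factor.\<close>

lemma kron_mult_kron:
  assumes A: "A \<in> carrier_mat a b" and B: "B \<in> carrier_mat c d"
    and A': "A' \<in> carrier_mat b a'" and B': "B' \<in> carrier_mat d c'"
  shows "kron A B * kron A' B' = kron (A * A') (B * B')"
proof (rule eq_matI)
  have K: "kron A B \<in> carrier_mat (a * c) (b * d)" "kron A' B' \<in> carrier_mat (b * d) (a' * c')"
    "kron (A * A') (B * B') \<in> carrier_mat (a * c) (a' * c')"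
    using assms by auto
  fix i j assume "i < dim_row (kron (A * A') (B * B'))" "j < dim_col (kron (A * A') (B * B'))"
  then have i: "i < a * c" and j: "j < a' * c'" using K by auto
  note ij = div_mod_less[OF i] div_mod_less[OF j]
  have "(kron A B * kron A' B') $$ (i, j)
     = (\<Sum>k<b * d. (A $$ (i div c, k div d) * B $$ (i mod c, k mod d)) *
                  (A' $$ (k div d, j div c') * B' $$ (k mod d, j mod c')))"
    unfolding index_mult_mat_sum[OF K(1,2) i j]
    using i j by (auto simp: kron_index[OF A B] kron_index[OF A' B'] intro!: sum.cong)
  also have "\<dots> = (\<Sum>k<b. \<Sum>l<d. (A $$ (i div c, k) * B $$ (i mod c, l)) *
                  (A' $$ (k, j div c') * B' $$ (l, j mod c')))"
    by (rule sum_div_mod)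
  also have "\<dots> = (A * A') $$ (i div c, j div c') * (B * B') $$ (i mod c, j mod c')"
    unfolding index_mult_mat_sum[OF A A' ij(1,3)] index_mult_mat_sum[OF B B' ij(2,4)] sum_product
    by (simp add: mult_ac)
  also have "\<dots> = kron (A * A') (B * B') $$ (i, j)"
    using assms i j by (subst kron_index[of _ a a' _ c c']) auto
  finally show "(kron A B * kron A' B') $$ (i, j) = kron (A * A') (B * B') $$ (i, j)" .
qed (use assms in \<open>auto simp: kron_def\<close>)

lemma kron_one: "kron (1\<^sub>m a) (1\<^sub>m b) = 1\<^sub>m (a * b)"
proof (rule eq_matI)
  fix i j assume "i < dim_row (1\<^sub>m (a * b) :: complex mat)" "j < dim_col (1\<^sub>m (a * b) :: complex mat)"
  then have i: "i < a * b" and j: "j < a * b" by auto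
  have "i div b = j div b \<and> i mod b = j mod b \<longleftrightarrow> i = j"
    by (metis div_mult_mod_eq)
  then show "kron (1\<^sub>m a) (1\<^sub>m b) $$ (i, j) = 1\<^sub>m (a * b) $$ (i, j)"
    using i j div_mod_less[OF i] div_mod_less[OF j]
    by (subst kron_index[of _ a a _ b b]) auto
qed (auto simp: kron_def)

lemma mat_adjoint_kron: "mat_adjoint (kron A B) = kron (mat_adjoint A) (mat_adjoint B)"
  by (rule eq_matI) (auto simp: kron_def mat_adjoint_index div_mod_less)

lemma transpose_kron: "transpose_mat (kron A B) = kron (transpose_mat A) (transpose_mat B)"
  by (rule eq_matI) (auto simp: kron_def div_mod_less)

lemma kron_smult: "kron (s \<cdot>\<^sub>m A) (t \<cdot>\<^sub>m B) = (s * t) \<cdot>\<^sub>m kron A B"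
  by (rule eq_matI) (auto simp: kron_def div_mod_less)

text \<open>Peels off the leftmost qubit, matching the nesting of \<open>foldr kron\<close>. The
  predicate also takes the qubit number, so that it can mention dimensions.\<close>

lemma pauli_ops_induct [consumes 1, case_names one kron]:
  assumes "P \<in> pauli_ops n" and "R 0 (1\<^sub>m 1)"
    and "\<And>n A B. A \<in> {pauli_I, pauli_X, pauli_Y, pauli_Z} \<Longrightarrow> R n B \<Longrightarrow> R (Suc n) (kron A B)"
  shows "R n P"
proof -
  obtain ps where "P = foldr kron ps (1\<^sub>m 1)" "length ps = n"
    "set ps \<subseteq> {pauli_I, pauli_X, pauli_Y, pauli_Z}"
    using assms(1) by (auto simp: pauli_ops_def)
  then show ?thesis
    by (induction ps arbitrary: P n) (use assms(2,3) in auto)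
qed

section \<open>Single-qubit Pauli matrices\<close>

lemma pauli_carrier: "A \<in> {pauli_I, pauli_X, pauli_Y, pauli_Z} \<Longrightarrow> A \<in> carrier_mat 2 2"
  by (auto simp: pauli_I_def pauli_X_def pauli_Y_def pauli_Z_def mat_of_rows_list_def)

lemma pauli_square: "A \<in> {pauli_I, pauli_X, pauli_Y, pauli_Z} \<Longrightarrow> A * A = 1\<^sub>m 2"
  by (auto simp: pauli_I_def pauli_X_def pauli_Y_def pauli_Z_def mat_of_rows_list_def
      scalar_prod_def less_2_cases_iff intro!: eq_matI)

lemma pauli_hermitian:
  assumes "A \<in> {pauli_I, pauli_X, pauli_Y, pauli_Z}"
  shows "mat_adjoint A = A"
proof (rule eq_matI)
  have A: "dim_row A = 2" "dim_col A = 2"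
    using pauli_carrier[OF assms] by auto
  then show "dim_row (mat_adjoint A) = dim_row A" "dim_col (mat_adjoint A) = dim_col A"
    by simp_all
  fix i j assume "i < dim_row A" "j < dim_col A"
  with A assms show "mat_adjoint A $$ (i, j) = A $$ (i, j)"
    by (auto simp: mat_adjoint_index less_2_cases_iff)
       (auto simp: pauli_I_def pauli_X_def pauli_Y_def pauli_Z_def mat_of_rows_list_def)
qed

text \<open>Only \<open>pauli_Y\<close> is antisymmetric; the other three matrices are
  symmetric.\<close>

lemma pauli_transpose:
  assumes "A \<in> {pauli_I, pauli_X, pauli_Y, pauli_Z}"
  shows "\<exists>s\<in>{1, - 1}. transpose_mat A = s \<cdot>\<^sub>m A"
proof -
  have "transpose_mat pauli_I = 1 \<cdot>\<^sub>m pauli_I" "transpose_mat pauli_X = 1 \<cdot>\<^sub>m pauli_X"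
    "transpose_mat pauli_Y = (- 1) \<cdot>\<^sub>m pauli_Y" "transpose_mat pauli_Z = 1 \<cdot>\<^sub>m pauli_Z"
    by (rule eq_matI; auto simp: pauli_I_def pauli_X_def pauli_Y_def pauli_Z_def mat_of_rows_list_def
        less_Suc_eq numeral_2_eq_2)+
  then show ?thesis using assms by blast
qed

section \<open>Pauli strings: dimension, square, adjoint and transpose\<close>

lemma pauli_ops_carrier: "P \<in> pauli_ops n \<Longrightarrow> P \<in> carrier_mat (2 ^ n) (2 ^ n)"
proof (induction rule: pauli_ops_induct)
  case (kron n A B)
  then show ?case
    using kron_carrier[OF pauli_carrier] by simp
qed auto

lemma pauli_ops_square:
  assumes "P \<in> pauli_ops n"
  shows "P * P = 1\<^sub>m (2 ^ n)"
proof -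
  \<comment> \<open>The dimension is carried through the induction because
    \<open>kron_mult_kron\<close> needs it for the remaining string.\<close>
  have "P \<in> carrier_mat (2 ^ n) (2 ^ n) \<and> P * P = 1\<^sub>m (2 ^ n)"
    using assms
  proof (induction rule: pauli_ops_induct)
    case (kron n A B)
    then show ?case
      using kron_mult_kron[of A 2 2 B "2 ^ n" "2 ^ n" A 2 B "2 ^ n"] pauli_carrier pauli_square kron_one[of 2 "2 ^ n"]
      by (metis kron_carrier power_Suc)
  qed auto
  then show ?thesis ..
qed

lemma pauli_ops_hermitian: "P \<in> pauli_ops n \<Longrightarrow> mat_adjoint P = P"
  by (induction rule: pauli_ops_induct)
     (use pauli_hermitian in \<open>auto simp: mat_adjoint_kron mat_adjoint_index intro!: eq_matI\<close>)

text \<open>Transposition acts factorwise and the signs multiply, so the sign is the parity of the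
  number of \<open>pauli_Y\<close> factors. It is known to the post-processing.\<close>

lemma pauli_ops_transpose:
  assumes "P \<in> pauli_ops n"
  shows "\<exists>s\<in>{1, - 1}. transpose_mat P = s \<cdot>\<^sub>m P"
  using assms
proof (induction rule: pauli_ops_induct)
  case (kron n A B)
  then obtain s where s: "s \<in> {1, - 1}" "transpose_mat B = s \<cdot>\<^sub>m B" by blast
  obtain t where t: "t \<in> {1, - 1}" "transpose_mat A = t \<cdot>\<^sub>m A"
    using pauli_transpose[OF kron(1)] by blast
  have "transpose_mat (kron A B) = (t * s) \<cdot>\<^sub>m kron A B"
    by (simp add: transpose_kron kron_smult s t)
  moreover have "t * s \<in> {1, - 1}" using s t by auto
  ultimately show ?case by blast
qed (auto intro!: bexI[of _ 1])

section \<open>Common eigenbases of commuting involutions\<close>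

lemma cscalar_prod_add_left:
  fixes u v w :: "complex vec"
  assumes "u \<in> carrier_vec d" "v \<in> carrier_vec d" "w \<in> carrier_vec d"
  shows "(u + v) \<bullet>c w = u \<bullet>c w + v \<bullet>c w"
  using assms by (simp add: cscalar_prod_sum sum.distrib algebra_simps)

lemma cscalar_prod_smult_left:
  fixes v w :: "complex vec"
  assumes "v \<in> carrier_vec d" "w \<in> carrier_vec d"
  shows "(c \<cdot>\<^sub>v v) \<bullet>c w = c * (v \<bullet>c w)"
  using assms by (simp add: cscalar_prod_sum sum_distrib_left mult_ac)

lemma cscalar_prod_smult_right:
  fixes v w :: "complex vec"
  assumes "v \<in> carrier_vec d" "w \<in> carrier_vec d"
  shows "v \<bullet>c (c \<cdot>\<^sub>v w) = cnj c * (v \<bullet>c w)"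
  using assms by (simp add: cscalar_prod_sum sum_distrib_left mult_ac)

lemma cscalar_prod_commute:
  fixes v w :: "complex vec"
  assumes "v \<in> carrier_vec d" "w \<in> carrier_vec d"
  shows "w \<bullet>c v = cnj (v \<bullet>c w)"
  using assms by (simp add: cscalar_prod_sum mult.commute)

text \<open>Applying \<open>A\<close> twice multiplies \<open>v\<close> by \<open>c * c\<close> and
  also fixes it; comparing a nonzero entry gives \<open>c * c = 1\<close>.\<close>

lemma involution_eigenvalue:
  assumes A: "A \<in> carrier_mat d d" "A * A = 1\<^sub>m d" and ev: "eigenvector A v (c :: complex)"
  shows "c \<in> {1, - 1}"
proof -
  have v: "v \<in> carrier_vec d" "v \<noteq> 0\<^sub>v d" "A *\<^sub>v v = c \<cdot>\<^sub>v v"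
    using ev A by (auto simp: eigenvector_def)
  obtain i where i: "i < d" "v $ i \<noteq> 0"
    using v by (metis carrier_vecD dim_vec index_zero_vec eq_vecI)
  have "v = (A * A) *\<^sub>v v" using A(2) v by simp
  also have "\<dots> = c \<cdot>\<^sub>v (c \<cdot>\<^sub>v v)"
    using A(1) v(1) by (simp add: assoc_mult_mat_vec[OF A(1) A(1) v(1)] v(3) mult_mat_vec)
  finally have "v $ i = (c \<cdot>\<^sub>v (c \<cdot>\<^sub>v v)) $ i" by simp
  then have "c * c = 1" using i v(1) by (simp add: mult.assoc[symmetric])
  then show ?thesis by (simp add: square_eq_1_iff)
qed

text \<open>Orthogonality to \<open>k\<close> vectors is a system of \<open>k\<close> homogeneous
  linear equations in \<open>d > k\<close> unknowns. Zero rows pad it to a square matrix, whose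
  vanishing determinant yields a nonzero kernel vector.\<close>

lemma exists_orthogonal_vec:
  fixes b :: "nat \<Rightarrow> complex vec"
  assumes "k < d" and b: "\<And>j. j < k \<Longrightarrow> b j \<in> carrier_vec d"
  shows "\<exists>v\<in>carrier_vec d. v \<noteq> 0\<^sub>v d \<and> (\<forall>j<k. v \<bullet>c b j = 0)"
proof -
  define B where "B = mat d d (\<lambda>(i, j). if i < k then cnj (b i $ j) else 0)"
  have B: "B \<in> carrier_mat d d" by (simp add: B_def)
  \<comment> \<open>As \<open>k < d\<close>, row \<open>d - 1\<close> of \<open>B\<close> is one of
    the padded zero rows, so the last unit vector lies in the kernel of the transpose.\<close>
  have "transpose_mat B *\<^sub>v unit_vec d (d - 1) = 0\<^sub>v d"
    using \<open>k < d\<close> by (intro eq_vecI) (auto simp: B_def)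
  moreover have "unit_vec d (d - 1) \<noteq> (0\<^sub>v d :: complex vec)" "unit_vec d (d - 1) \<in> carrier_vec d"
    using \<open>k < d\<close> by (auto simp: unit_vec_nonzero)
  ultimately have "det (transpose_mat B) = 0"
    using det_0_iff_vec_prod_zero[of "transpose_mat B" d] B by (metis transpose_carrier_mat)
  then have "det B = 0" using det_transpose[OF B] by simp
  then obtain v where v: "v \<in> carrier_vec d" "v \<noteq> 0\<^sub>v d" "B *\<^sub>v v = 0\<^sub>v d"
    using det_0_iff_vec_prod_zero[OF B] by blast
  have "v \<bullet>c b j = 0" if "j < k" for j
  proof -
    have "(B *\<^sub>v v) $ j = (\<Sum>i<d. B $$ (j, i) * v $ i)"
      using that \<open>k < d\<close> by (intro index_mult_mat_vec_sum[OF B v(1)]) simp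
    also have "\<dots> = v \<bullet>c b j"
      using that \<open>k < d\<close> b[OF that] by (simp add: cscalar_prod_sum B_def mult.commute)
    finally have "v \<bullet>c b j = (B *\<^sub>v v) $ j" ..
    then show ?thesis using that \<open>k < d\<close> by (simp add: v(3))
  qed
  then show ?thesis using v by blast
qed

text \<open>If \<open>A\<close> is an involution, then \<open>A v + v\<close> is fixed by \<open>A\<close> unless it vanishes, in which case
  \<open>A v = - v\<close>. Passing from \<open>v\<close> to \<open>A v + v\<close> preserves the eigenvector property for matrices commuting
  with \<open>A\<close> and orthogonality to eigenvectors of \<open>A\<close>.\<close>

lemma common_eigenvector_orthogonal:
  fixes A :: "nat \<Rightarrow> complex mat" and b :: "nat \<Rightarrow> complex vec"
  assumes A: "\<And>i. i < M \<Longrightarrow> A i \<in> carrier_mat d d" "\<And>i. i < M \<Longrightarrow> A i * A i = 1\<^sub>m d"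
    "\<And>i. i < M \<Longrightarrow> mat_adjoint (A i) = A i"
    and comm: "\<And>i j. i < M \<Longrightarrow> j < M \<Longrightarrow> A i * A j = A j * A i"
    and "k < d"
    and b: "\<And>j i. j < k \<Longrightarrow> i < M \<Longrightarrow> \<exists>c. eigenvector (A i) (b j) c" "\<And>j. j < k \<Longrightarrow> b j \<in> carrier_vec d"
  shows "\<exists>v\<in>carrier_vec d. v \<noteq> 0\<^sub>v d \<and> (\<forall>j<k. v \<bullet>c b j = 0) \<and> (\<forall>i<M. \<exists>c. A i *\<^sub>v v = c \<cdot>\<^sub>v v)"
proof -
  \<comment> \<open>Induction on the number \<open>m\<close> of matrices already diagonalized on
    \<open>v\<close>, starting from any nonzero vector orthogonal to the given ones.\<close>
  have "\<exists>v\<in>carrier_vec d. v \<noteq> 0\<^sub>v d \<and> (\<forall>j<k. v \<bullet>c b j = 0) \<and> (\<forall>i<m. \<exists>c. A i *\<^sub>v v = c \<cdot>\<^sub>v v)"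
    if "m \<le> M" for m
    using that
  proof (induction m)
    case 0
    then show ?case using exists_orthogonal_vec[OF \<open>k < d\<close> b(2)] by auto
  next
    case (Suc m)
    then obtain v where v: "v \<in> carrier_vec d" "v \<noteq> 0\<^sub>v d" "\<And>j. j < k \<Longrightarrow> v \<bullet>c b j = 0"
      "\<And>i. i < m \<Longrightarrow> \<exists>c. A i *\<^sub>v v = c \<cdot>\<^sub>v v" by auto
    have m: "m < M" using Suc.prems by simp
    note Am = A[OF m]
    define w where "w = A m *\<^sub>v v + v"
    have Av: "A m *\<^sub>v v \<in> carrier_vec d" using Am(1) v(1) by simp
    show ?case
    proof (cases "w = 0\<^sub>v d")
      case True
      have "A m *\<^sub>v v = (- 1) \<cdot>\<^sub>v v"
      proof (rule eq_vecI)
        fix i assume "i < dim_vec ((- 1) \<cdot>\<^sub>v v)"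
        then have i: "i < d" using v(1) by simp
        then have "w $ i = 0" by (simp add: True)
        then show "(A m *\<^sub>v v) $ i = ((- 1) \<cdot>\<^sub>v v) $ i"
          using i Am(1) Av v(1) by (simp add: w_def eq_neg_iff_add_eq_0 del: index_mult_mat_vec)
      qed (use Am(1) v(1) in auto)
      then show ?thesis using v by (metis less_Suc_eq)
    next
      case False
      have wc: "w \<in> carrier_vec d" using Av v(1) by (simp add: w_def)
      have "A m *\<^sub>v w = (A m * A m) *\<^sub>v v + A m *\<^sub>v v"
        unfolding w_def using mult_add_distrib_mat_vec[OF Am(1) Av v(1)]
          assoc_mult_mat_vec[OF Am(1) Am(1) v(1)] by simp
      also have "\<dots> = 1 \<cdot>\<^sub>v w"
        using v(1) Av by (simp add: Am(2) w_def comm_add_vec[of _ d])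
      finally have Amw: "A m *\<^sub>v w = 1 \<cdot>\<^sub>v w" .
      have "\<exists>c. A i *\<^sub>v w = c \<cdot>\<^sub>v w" if im: "i < m" for i
      proof -
        have i: "i < M" using im m by simp
        obtain c where c: "A i *\<^sub>v v = c \<cdot>\<^sub>v v" using v(4)[OF im] by blast
        have "A i *\<^sub>v w = (A i * A m) *\<^sub>v v + A i *\<^sub>v v"
          unfolding w_def using mult_add_distrib_mat_vec[OF A(1)[OF i] Av v(1)]
            assoc_mult_mat_vec[OF A(1)[OF i] Am(1) v(1)] by simp
        also have "(A i * A m) *\<^sub>v v = A m *\<^sub>v (c \<cdot>\<^sub>v v)"
          using assoc_mult_mat_vec[OF Am(1) A(1)[OF i] v(1)] by (simp add: comm[OF i m] c)
        also have "\<dots> + A i *\<^sub>v v = c \<cdot>\<^sub>v w"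
          using mult_mat_vec[OF Am(1) v(1)] smult_add_distrib_vec[OF Av v(1)] by (simp add: c w_def)
        finally show ?thesis by blast
      qed
      moreover have "w \<bullet>c b j = 0" if j: "j < k" for j
      proof -
        obtain c where c: "A m *\<^sub>v b j = c \<cdot>\<^sub>v b j"
          using b(1)[OF j m] by (auto simp: eigenvector_def)
        \<comment> \<open>\<open>A m\<close> is Hermitian, so it moves onto \<open>b j\<close>,
          where it acts as a scalar; the product is then a multiple of
          \<open>v \<bullet>c b j\<close>.\<close>
        have "(A m *\<^sub>v v) \<bullet>c b j = 0"
          using cscalar_prod_mult_mat_vec[OF Am(1) v(1) b(2)[OF that]]
            cscalar_prod_smult_right[OF v(1) b(2)[OF that]] v(3)[OF that] by (simp add: Am(3) c)
        then show ?thesis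
          using cscalar_prod_add_left[OF Av v(1) b(2)[OF that]] v(3)[OF that] by (simp add: w_def)
      qed
      ultimately show ?thesis using wc False Amw by (metis less_Suc_eq)
    qed
  qed
  then show ?thesis by blast
qed

lemma normalize_vec:
  fixes v :: "complex vec"
  assumes "v \<in> carrier_vec d" "v \<noteq> 0\<^sub>v d"
  obtains c where "c \<noteq> 0" "(c \<cdot>\<^sub>v v) \<bullet>c (c \<cdot>\<^sub>v v) = 1"
proof -
  define s where "s = (\<Sum>i<d. (cmod (v $ i))\<^sup>2)"
  have sv: "v \<bullet>c v = complex_of_real s"
    using assms(1) by (simp add: cscalar_prod_sum s_def complex_norm_square del: of_real_power)
  have "v \<bullet>c v \<noteq> 0" using conjugate_square_eq_0_vec[OF assms(1)] assms(2) by blast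
  then have "s \<noteq> 0" using sv by auto
  then have "s > 0" by (simp add: s_def order.strict_iff_order sum_nonneg)
  show thesis
  proof
    show "complex_of_real (1 / sqrt s) \<noteq> 0" using \<open>s > 0\<close> by simp
    show "(complex_of_real (1 / sqrt s) \<cdot>\<^sub>v v) \<bullet>c (complex_of_real (1 / sqrt s) \<cdot>\<^sub>v v) = 1"
      using \<open>s > 0\<close> assms(1)
      by (simp add: cscalar_prod_smult_left[of _ d] cscalar_prod_smult_right[of _ d] sv flip: of_real_mult of_real_divide)
  qed
qed

text \<open>The basis grows one vector at a time: while fewer than \<open>d\<close> vectors are
  present, a common eigenvector orthogonal to all of them exists and is normalized. This shows that
  the prescribed measurement is available.\<close>

lemma common_eigenbasis_exists:
  fixes A :: "nat \<Rightarrow> complex mat"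
  assumes A: "\<And>i. i < M \<Longrightarrow> A i \<in> carrier_mat d d" "\<And>i. i < M \<Longrightarrow> A i * A i = 1\<^sub>m d"
    "\<And>i. i < M \<Longrightarrow> mat_adjoint (A i) = A i"
    and comm: "\<And>i j. i < M \<Longrightarrow> j < M \<Longrightarrow> A i * A j = A j * A i"
  shows "\<exists>b. common_eigenbasis d {A i | i. i < M} b"
proof -
  have "\<exists>b. (\<forall>j<k. b j \<in> carrier_vec d) \<and> (\<forall>i<k. \<forall>j<k. b i \<bullet>c b j = (if i = j then 1 else 0)) \<and>
      (\<forall>j<k. \<forall>i<M. \<exists>c. eigenvector (A i) (b j) c)" if "k \<le> d" for k
    using that
  proof (induction k)
    case (Suc k)
    then obtain b where b: "\<And>j. j < k \<Longrightarrow> b j \<in> carrier_vec d"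
      "\<And>i j. i < k \<Longrightarrow> j < k \<Longrightarrow> b i \<bullet>c b j = (if i = j then 1 else 0)"
      "\<And>i j. j < k \<Longrightarrow> i < M \<Longrightarrow> \<exists>c. eigenvector (A i) (b j) c"
      by (metis Suc_leD)
    have "k < d" using Suc.prems by simp
    have "\<exists>v\<in>carrier_vec d. v \<noteq> 0\<^sub>v d \<and> (\<forall>j<k. v \<bullet>c b j = 0) \<and>
        (\<forall>i<M. \<exists>c. A i *\<^sub>v v = c \<cdot>\<^sub>v v)"
      by (rule common_eigenvector_orthogonal[where M = M and A = A])
        (use A comm b \<open>k < d\<close> in auto)
    then obtain v where v: "v \<in> carrier_vec d" "v \<noteq> 0\<^sub>v d" "\<And>j. j < k \<Longrightarrow> v \<bullet>c b j = 0"
      "\<And>i. i < M \<Longrightarrow> \<exists>c. A i *\<^sub>v v = c \<cdot>\<^sub>v v" by blast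
    obtain c where c: "c \<noteq> 0" "(c \<cdot>\<^sub>v v) \<bullet>c (c \<cdot>\<^sub>v v) = 1"
      using normalize_vec[OF v(1,2)] by blast
    define w where "w = c \<cdot>\<^sub>v v"
    have w: "w \<in> carrier_vec d" "w \<bullet>c w = 1" using v(1) c by (auto simp: w_def)
    have wb: "w \<bullet>c b j = 0" "b j \<bullet>c w = 0" if "j < k" for j
    proof -
      show "w \<bullet>c b j = 0"
        using cscalar_prod_smult_left[OF v(1) b(1)[OF that]] v(3)[OF that] by (simp add: w_def)
      then show "b j \<bullet>c w = 0"
        using cscalar_prod_commute[OF w(1) b(1)[OF that]] by simp
    qed
    have "\<exists>e. eigenvector (A i) w e" if i: "i < M" for i
    proof -
      obtain e where e: "A i *\<^sub>v v = e \<cdot>\<^sub>v v" using v(4)[OF i] by blast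
      have "A i *\<^sub>v w = e \<cdot>\<^sub>v w"
        using mult_mat_vec[OF A(1)[OF i] v(1)] by (simp add: w_def e smult_smult_assoc mult.commute)
      moreover have "w \<noteq> 0\<^sub>v d" using w by auto
      ultimately show ?thesis using w A(1)[OF i] by (auto simp: eigenvector_def)
    qed
    then show ?case
      using b w wb by (intro exI[of _ "b(k := w)"]) (auto simp: less_Suc_eq)
  qed auto
  from this[of d] show ?thesis
    by (auto simp: common_eigenbasis_def orthonormal_basis_def)
qed

section \<open>Correlators as expectations of measurement outcomes\<close>

text \<open>Inserts the completeness relation of the basis between two different vectors. It is used
  with one of them an observable applied to the state.\<close>

lemma orthonormal_basis_parseval_polarized:
  assumes b: "orthonormal_basis d b" and v: "v \<in> carrier_vec d" and w: "w \<in> carrier_vec d"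
  shows "(\<Sum>k<d. (v \<bullet>c b k) * cnj (w \<bullet>c b k)) = v \<bullet>c w"
proof -
  have "(\<Sum>k<d. (v \<bullet>c b k) * cnj (w \<bullet>c b k))
      = (\<Sum>k<d. (\<Sum>i<d. v $ i * cnj (b k $ i)) * cnj (\<Sum>j<d. w $ j * cnj (b k $ j)))"
    using b by (auto simp: cscalar_prod_sum orthonormal_basis_def intro!: sum.cong)
  also have "\<dots> = (\<Sum>k<d. \<Sum>i<d. \<Sum>j<d. v $ i * cnj (w $ j) * (b k $ j * cnj (b k $ i)))"
    by (simp add: sum_product mult_ac)
  also have "\<dots> = (\<Sum>i<d. \<Sum>j<d. \<Sum>k<d. v $ i * cnj (w $ j) * (b k $ j * cnj (b k $ i)))"
    by (subst sum.swap, intro sum.cong refl sum.swap)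
  also have "\<dots> = (\<Sum>i<d. \<Sum>j<d. v $ i * cnj (w $ j) * (\<Sum>k<d. b k $ j * cnj (b k $ i)))"
    by (simp add: sum_distrib_left)
  also have "\<dots> = (\<Sum>i<d. \<Sum>j<d. if j = i then v $ i * cnj (w $ j) else 0)"
    by (intro sum.cong refl) (auto simp: orthonormal_basis_complete[OF b])
  also have "\<dots> = v \<bullet>c w"
    using w by (simp add: cscalar_prod_sum)
  finally show ?thesis .
qed

text \<open>\<open>A\<close> moves onto the eigenvector \<open>b k\<close> and gives the factor
  \<open>f k\<close>; so the Born weight times \<open>f k\<close> is one term of the polarized
  Parseval sum for \<open>A *\<^sub>v \<psi>\<close> and \<psi>.\<close>

lemma expectation_basis_measurement:
  assumes b: "orthonormal_basis d b" and psi: "\<psi> \<in> carrier_vec d" "\<psi> \<bullet>c \<psi> = 1"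
    and A: "A \<in> carrier_mat d d" "mat_adjoint A = A"
    and ev: "\<And>k. k < d \<Longrightarrow> A *\<^sub>v b k = complex_of_real (f k) \<cdot>\<^sub>v b k"
  shows "complex_of_real (measure_pmf.expectation (basis_measurement d b \<psi>) f) = (A *\<^sub>v \<psi>) \<bullet>c \<psi>"
proof -
  note pmf = pmf_basis_measurement[OF b psi]
  have "measure_pmf.expectation (basis_measurement d b \<psi>) f
      = (\<Sum>k<d. f k * pmf (basis_measurement d b \<psi>) k)"
    \<comment> \<open>Outcomes \<open>k \<ge> d\<close> have probability zero, so the values of
      \<open>f\<close> there do not contribute.\<close>
    by (rule integral_measure_pmf_real) (auto simp: set_pmf_eq pmf split: if_splits)
  also have "complex_of_real \<dots> = (\<Sum>k<d. ((A *\<^sub>v \<psi>) \<bullet>c b k) * cnj (\<psi> \<bullet>c b k))"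
    unfolding of_real_sum
  proof (rule sum.cong)
    fix k assume "k \<in> {..<d}"
    then have k: "k < d" and bk: "b k \<in> carrier_vec d"
      using b by (auto simp: orthonormal_basis_def)
    have "(A *\<^sub>v \<psi>) \<bullet>c b k = complex_of_real (f k) * (\<psi> \<bullet>c b k)"
      using cscalar_prod_mult_mat_vec[OF A(1) psi(1) bk] cscalar_prod_smult_right[OF psi(1) bk]
      by (simp add: A(2) ev[OF k])
    then show "complex_of_real (f k * pmf (basis_measurement d b \<psi>) k)
        = ((A *\<^sub>v \<psi>) \<bullet>c b k) * cnj (\<psi> \<bullet>c b k)"
      using k by (simp add: pmf complex_norm_square mult.assoc del: of_real_power)
  qed simp
  also have "\<dots> = (A *\<^sub>v \<psi>) \<bullet>c \<psi>"
    using A(1) psi(1) by (intro orthonormal_basis_parseval_polarized[OF b]) auto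
  finally show ?thesis .
qed

text \<open>\<open>P\<close> acts on the row index and \<open>Q\<close> on the column index of
  \<open>X\<close>, so \<open>kron P Q\<close> sends the vectorization of \<open>X\<close> to a
  multiple of that of P X Q^T. The two normalizing factors combine to 1 / c.\<close>

lemma kron_expectation_vectorize:
  assumes X: "X \<in> carrier_mat d d" "mat_adjoint X = X" and c: "mat_trace (X * X) = complex_of_real c" "c > 0"
    and P: "P \<in> carrier_mat d d" and Q: "Q \<in> carrier_mat d d"
  shows "(kron P Q *\<^sub>v vectorize X) \<bullet>c vectorize X
    = mat_trace (X * P * X * transpose_mat Q) / c"
proof -
  have K: "kron P Q \<in> carrier_mat (d * d) (d * d)" using P Q by auto
  have V: "vectorize X \<in> carrier_vec (d * d)" using X(1) by (auto simp: vectorize_def)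
  have vec: "vectorize X $ r = X $$ (r div d, r mod d) / complex_of_real (sqrt c)" if "r < d * d" for r
    using that X c by (simp add: vectorize_def)
  have cc: "complex_of_real (sqrt c) * complex_of_real (sqrt c) = complex_of_real c"
    using c(2) by (simp flip: of_real_mult)
  \<comment> \<open>Hermiticity turns the conjugated entry from the inner product into an ordinary
    entry of \<open>X\<close>, as the trace requires.\<close>
  have sa: "cnj (X $$ (i, j)) = X $$ (j, i)" if "i < d" "j < d" for i j
    using mat_adjoint_index[of j X i] that X by simp
  have "(kron P Q *\<^sub>v vectorize X) \<bullet>c vectorize X
     = (\<Sum>r<d * d. \<Sum>t<d * d. P $$ (r div d, t div d) * Q $$ (r mod d, t mod d) *
          X $$ (t div d, t mod d) * X $$ (r mod d, r div d) / c)"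
    using V div_mod_less[of _ d d]
    by (auto simp: cscalar_prod_sum index_mult_mat_vec_sum[OF K V] kron_index[OF P Q] vec sa
        sum_distrib_right sum_distrib_left sum_divide_distrib cc[symmetric] simp del: index_mult_mat_vec of_real_mult intro!: sum.cong)
  also have "\<dots> = (\<Sum>r<d * d. \<Sum>k<d. \<Sum>l<d. P $$ (r div d, k) * Q $$ (r mod d, l) *
          X $$ (k, l) * X $$ (r mod d, r div d) / c)"
    by (rule sum.cong[OF refl], rule sum_div_mod)
  also have "\<dots> = (\<Sum>i<d. \<Sum>j<d. \<Sum>k<d. \<Sum>l<d. P $$ (i, k) * Q $$ (j, l) * X $$ (k, l) * X $$ (j, i) / c)"
    by (rule sum_div_mod)
  \<comment> \<open>The sums are brought into the order j, l, k, i, in which the trace of the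
    product X P X Q^T expands.\<close>
  also have "\<dots> = (\<Sum>j<d. \<Sum>i<d. \<Sum>l<d. \<Sum>k<d. P $$ (i, k) * Q $$ (j, l) * X $$ (k, l) * X $$ (j, i) / c)"
    by (subst sum.swap, rule sum.cong[OF refl], rule sum.cong[OF refl], rule sum.swap)
  also have "\<dots> = (\<Sum>j<d. \<Sum>l<d. \<Sum>k<d. \<Sum>i<d. P $$ (i, k) * Q $$ (j, l) * X $$ (k, l) * X $$ (j, i) / c)"
    by (rule sum.cong[OF refl], subst sum.swap, rule sum.cong[OF refl], subst sum.swap, rule refl)
  also have "\<dots> = mat_trace (X * P * X * transpose_mat Q) / c"
  proof -
    have XP: "X * P \<in> carrier_mat d d" and XPX: "X * P * X \<in> carrier_mat d d"
      using X P by auto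
    show ?thesis
      using Q by (subst mat_trace_mult[OF XPX])
        (auto simp: index_mult_mat_sum[OF XP X(1)] index_mult_mat_sum[OF X(1) P] sum_divide_distrib
          sum_distrib_left sum_distrib_right mult_ac simp del: index_mult_mat(1) intro!: sum.cong)
  qed
  finally show ?thesis .
qed

text \<open>Unitary conjugation preserves everything assumed of the operator, so the estimation can
  be proved for an arbitrary Hermitian \<open>X\<close> in place of O(t). The trace follows from
  cancelling \<open>U * mat_adjoint U\<close> and cyclicity.\<close>

lemma heisenberg_hermitian:
  assumes "H \<in> carrier_mat d d" "hermitian H" "unitary d U"
  shows "heisenberg U H \<in> carrier_mat d d" "mat_adjoint (heisenberg U H) = heisenberg U H"
    "mat_trace (heisenberg U H * heisenberg U H) = mat_trace (H * H)"
proof -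
  have U: "U \<in> carrier_mat d d" "U * mat_adjoint U = 1\<^sub>m d" and H: "H \<in> carrier_mat d d" "mat_adjoint H = H"
    using assms by (auto simp: unitary_def hermitian_def)
  have V: "mat_adjoint U \<in> carrier_mat d d" using U by auto
  have VH: "mat_adjoint U * H \<in> carrier_mat d d" and HU: "H * U \<in> carrier_mat d d" using U V H by auto
  show hc: "heisenberg U H \<in> carrier_mat d d" using U H V by (auto simp: heisenberg_def)
  show "mat_adjoint (heisenberg U H) = heisenberg U H"
    by (simp add: heisenberg_def mat_adjoint_mult[OF V HU] mat_adjoint_mult[OF H(1) U(1)]
        mat_adjoint_mat_adjoint H(2) assoc_mult_mat[OF V H(1) U(1)])
  have "heisenberg U H * heisenberg U H = mat_adjoint U * H * (U * (mat_adjoint U * (H * U)))"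
    unfolding heisenberg_def
    using assoc_mult_mat[OF V H(1) U(1)] assoc_mult_mat[OF VH U(1)] VH HU V U H
    by (metis mult_carrier_mat)
  also have "U * (mat_adjoint U * (H * U)) = H * U"
    using assoc_mult_mat[OF U(1) V HU] left_mult_one_mat[OF HU] U(2) by simp
  also have "mat_trace (mat_adjoint U * H * (H * U)) = mat_trace (H * U * (mat_adjoint U * H))"
    by (rule mat_trace_comm[OF VH HU])
  also have "H * U * (mat_adjoint U * H) = H * (U * mat_adjoint U * H)"
    using assoc_mult_mat[OF H(1) U(1) VH] assoc_mult_mat[OF U(1) V H(1)] by simp
  also have "\<dots> = H * H" using H(1) U(2) by simp
  finally show "mat_trace (heisenberg U H * heisenberg U H) = mat_trace (H * H)" .
qed

text \<open>The estimator is chosen before \<open>X\<close> is quantified: it is built from the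
  Pauli strings, the basis and \<open>N\<close> alone, so it sees \<open>X\<close> only through the
  outcomes.\<close>

lemma otoc_estimation:
  fixes P Q :: "nat \<Rightarrow> complex mat" and M N n :: nat and \<epsilon> \<delta> :: real
  assumes PQ: "\<And>i. i < M \<Longrightarrow> P i \<in> pauli_ops n" "\<And>i. i < M \<Longrightarrow> Q i \<in> pauli_ops n"
    and b: "common_eigenbasis (2 ^ n * 2 ^ n) {kron (P i) (Q i) | i. i < M} b"
    and N: "real N \<ge> 2 * ln (2 * M / \<delta>) / \<epsilon>\<^sup>2" "N > 0" and "M > 0" "\<epsilon> > 0" "\<delta> > 0"
  shows "\<exists>estimate :: nat list \<Rightarrow> nat \<Rightarrow> real.
    \<forall>X. X \<in> carrier_mat (2 ^ n) (2 ^ n) \<longrightarrow> mat_adjoint X = X \<longrightarrow> mat_trace (X * X) = 2 ^ n \<longrightarrow>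
      measure_pmf.prob (replicate_pmf N (basis_measurement (2 ^ n * 2 ^ n) b (vectorize X)))
        {outcomes. \<forall>i<M. cmod (complex_of_real (estimate outcomes i) - otoc n X (P i) (Q i)) \<le> \<epsilon>}
      \<ge> 1 - \<delta>"
proof -
  define d :: nat where "d = 2 ^ n"
  define A where "A i = kron (P i) (Q i)" for i
  have Pc: "P i \<in> carrier_mat d d" and Qc: "Q i \<in> carrier_mat d d" if "i < M" for i
    using PQ[OF that] pauli_ops_carrier by (auto simp: d_def)
  have A: "A i \<in> carrier_mat (d * d) (d * d)" "A i * A i = 1\<^sub>m (d * d)" "mat_adjoint (A i) = A i"
    if "i < M" for i
    using kron_mult_kron[OF Pc[OF that] Qc[OF that] Pc[OF that] Qc[OF that]] Pc[OF that] Qc[OF that] PQ[OF that]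
    by (auto simp: A_def mat_adjoint_kron pauli_ops_hermitian pauli_ops_square kron_one simp flip: d_def)
  have onb: "orthonormal_basis (d * d) b"
    using b by (simp add: common_eigenbasis_def d_def)
  \<comment> \<open>Each outcome \<open>k\<close> determines the eigenvalue of every
    \<open>A i\<close>, so one measurement yields a value for all correlators at once.\<close>
  have "\<exists>f :: real. f \<in> {1, - 1} \<and> A i *\<^sub>v b k = complex_of_real f \<cdot>\<^sub>v b k" if ik: "i < M" "k < d * d" for i k
  proof -
    obtain c where c: "eigenvector (A i) (b k) c"
      using b ik unfolding common_eigenbasis_def d_def A_def by blast
    then show ?thesis
      using involution_eigenvalue[OF A(1,2)[OF ik(1)] c]
      by (auto simp: eigenvector_def intro: exI[of _ 1] exI[of _ "- 1"])
  qed
  then obtain f :: "nat \<Rightarrow> nat \<Rightarrow> real" where f: "\<And>i k. i < M \<Longrightarrow> k < d * d \<Longrightarrow> f i k \<in> {1, - 1}"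
    "\<And>i k. i < M \<Longrightarrow> k < d * d \<Longrightarrow> A i *\<^sub>v b k = complex_of_real (f i k) \<cdot>\<^sub>v b k"
    by metis
  have "\<exists>s :: real. s \<in> {1, - 1} \<and> transpose_mat (Q i) = complex_of_real s \<cdot>\<^sub>m Q i" if "i < M" for i
    using pauli_ops_transpose[OF PQ(2)[OF that]] by (auto intro: exI[of _ 1] exI[of _ "- 1"])
  then obtain s :: "nat \<Rightarrow> real" where s: "\<And>i. i < M \<Longrightarrow> s i \<in> {1, - 1}"
    "\<And>i. i < M \<Longrightarrow> transpose_mat (Q i) = complex_of_real (s i) \<cdot>\<^sub>m Q i"
    by metis
  \<comment> \<open>The empirical mean of the eigenvalues, corrected by the transposition sign of
    \<open>Q i\<close>.\<close>
  define est where "est xs i = s i * (sum_list (map (f i) xs) / real N)" for xs i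
  have "measure_pmf.prob (replicate_pmf N (basis_measurement (d * d) b (vectorize X)))
        {xs. \<forall>i<M. cmod (complex_of_real (est xs i) - otoc n X (P i) (Q i)) \<le> \<epsilon>} \<ge> 1 - \<delta>"
    if X: "X \<in> carrier_mat d d" "mat_adjoint X = X" and tr: "mat_trace (X * X) = 2 ^ n" for X
  proof -
    let ?\<psi> = "vectorize X"
    let ?p = "basis_measurement (d * d) b ?\<psi>"
    \<comment> \<open>A nonzero trace excludes the zero matrix, so the vectorization is a unit
      vector and the Born weights form a distribution.\<close>
    have "X \<noteq> 0\<^sub>m d d"
      using tr by (auto simp: mat_trace_def)
    note \<psi> = vectorize_unit[OF X(1) this]
    have "otoc n X (P i) (Q i) = complex_of_real (s i * measure_pmf.expectation ?p (f i))" if i: "i < M" for i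
    proof -
      have XPX: "X * P i * X \<in> carrier_mat d d"
        using X Pc[OF i] by auto
      have "complex_of_real (measure_pmf.expectation ?p (f i)) = (A i *\<^sub>v ?\<psi>) \<bullet>c ?\<psi>"
        by (intro expectation_basis_measurement onb \<psi> A f i)
      also have "\<dots> = mat_trace (X * P i * X * transpose_mat (Q i)) / complex_of_real (2 ^ n)"
        unfolding A_def by (rule kron_expectation_vectorize[OF X _ _ Pc[OF i] Qc[OF i]]) (simp_all add: tr)
      also have "mat_trace (X * P i * X * transpose_mat (Q i))
          = complex_of_real (s i) * mat_trace (X * P i * X * Q i)"
        using Qc[OF i] by (simp add: s(2)[OF i] mat_trace_mult[OF XPX] sum_distrib_left mult_ac)
      finally show ?thesis
        \<comment> \<open>The expectation equals \<open>s i\<close> times the correlator; since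
          \<open>s i\<close> squares to 1, the sign can change sides.\<close>
        using s(1)[OF i] by (auto simp: otoc_def)
    qed
    \<comment> \<open>The correlator is real and \<open>s i\<close> has modulus 1, so the complex
      error equals the deviation of the empirical mean.\<close>
    then have "cmod (complex_of_real (est xs i) - otoc n X (P i) (Q i))
        = \<bar>sum_list (map (f i) xs) / real N - measure_pmf.expectation ?p (f i)\<bar>" if "i < M" for xs i
      using s(1)[OF that]
      by (simp only: est_def that norm_of_real abs_mult flip: of_real_diff right_diff_distrib) auto
    moreover have "measure_pmf.prob (replicate_pmf N ?p)
      {xs. \<forall>i<M. \<bar>sum_list (map (f i) xs) / real N - measure_pmf.expectation ?p (f i)\<bar> \<le> \<epsilon>} \<ge> 1 - \<delta>"
    proof (rule replicate_pmf_simultaneous_means)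
      fix i k assume "i < M" "k \<in> set_pmf ?p"
      then show "\<bar>f i k\<bar> \<le> 1"
        \<comment> \<open>\<open>f i\<close> is specified only below \<open>d * d\<close>, which
          contains the support of the outcome distribution.\<close>
        using f(1)[of i k] by (auto simp: set_pmf_eq pmf_basis_measurement[OF onb \<psi>] split: if_splits)
    qed (use assms in auto)
    ultimately show ?thesis by simp
  qed
  then show ?thesis unfolding d_def by blast
qed

theorem theorem3:
  "\<exists>C\<^sub>0 :: real. C\<^sub>0 > 0 \<and>
    (\<forall>(n :: nat) (M :: nat) (P :: nat \<Rightarrow> complex mat) (Q :: nat \<Rightarrow> complex mat)
      (\<epsilon> :: real) (\<delta> :: real).
      n \<ge> 1 \<longrightarrow> M \<ge> 1 \<longrightarrow>
      (\<forall>i<M. P i \<in> pauli_ops n \<and> Q i \<in> pauli_ops n) \<longrightarrow>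
      (\<forall>i<M. \<forall>j<M. kron (P i) (Q i) * kron (P j) (Q j) = kron (P j) (Q j) * kron (P i) (Q i)) \<longrightarrow>
      0 < \<epsilon> \<longrightarrow> \<epsilon> < 1 \<longrightarrow> 0 < \<delta> \<longrightarrow> \<delta> \<le> 1 / 2 \<longrightarrow>
      (\<exists>N :: nat. real N \<le> C\<^sub>0 * ln (real M / \<delta>) / \<epsilon>\<^sup>2 \<and>
        (\<exists>b. common_eigenbasis (2 ^ n * 2 ^ n) {kron (P i) (Q i) | i. i < M} b) \<and>
        (\<forall>b. common_eigenbasis (2 ^ n * 2 ^ n) {kron (P i) (Q i) | i. i < M} b \<longrightarrow>
          (\<exists>estimate :: nat list \<Rightarrow> nat \<Rightarrow> real.
            \<forall>H U. H \<in> carrier_mat (2 ^ n) (2 ^ n) \<longrightarrow> hermitian H \<longrightarrow>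
              mat_trace (H * H) = 2 ^ n \<longrightarrow> unitary (2 ^ n) U \<longrightarrow>
              measure_pmf.prob
                (replicate_pmf N
                  (basis_measurement (2 ^ n * 2 ^ n) b (vectorize (heisenberg U H))))
                {outcomes. \<forall>i<M.
                  cmod (complex_of_real (estimate outcomes i)
                        - otoc n (heisenberg U H) (P i) (Q i)) \<le> \<epsilon>}
              \<ge> 1 - \<delta>))))"
proof (intro exI[of _ "6 :: real"] conjI allI impI)
  fix n M :: nat and P Q :: "nat \<Rightarrow> complex mat" and \<epsilon> \<delta> :: real
  assume M: "M \<ge> 1" and PQ: "\<forall>i<M. P i \<in> pauli_ops n \<and> Q i \<in> pauli_ops n"
    and comm: "\<forall>i<M. \<forall>j<M. kron (P i) (Q i) * kron (P j) (Q j) = kron (P j) (Q j) * kron (P i) (Q i)"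
    and \<epsilon>: "0 < \<epsilon>" "\<epsilon> < 1" and \<delta>: "0 < \<delta>" "\<delta> \<le> 1 / 2"
  let ?S = "{kron (P i) (Q i) | i. i < M}"
  \<comment> \<open>\<open>N\<close> is fixed before any eigenbasis, so the same number of samples
    serves every choice of \<open>b\<close>; its upper bound supplies the constant 6.\<close>
  obtain N :: nat where N: "N > 0" "real N \<ge> 2 * ln (2 * M / \<delta>) / \<epsilon>\<^sup>2"
    "real N \<le> 6 * ln (M / \<delta>) / \<epsilon>\<^sup>2"
    using sample_size[OF M \<epsilon> \<delta>] .
  have "\<exists>b. common_eigenbasis (2 ^ n * 2 ^ n) ?S b"
  proof (rule common_eigenbasis_exists)
    fix i assume "i < M"
    then have i: "P i \<in> pauli_ops n" "Q i \<in> pauli_ops n" using PQ by auto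
    note c = i[THEN pauli_ops_carrier]
    show "kron (P i) (Q i) \<in> carrier_mat (2 ^ n * 2 ^ n) (2 ^ n * 2 ^ n)"
      using c by auto
    show "kron (P i) (Q i) * kron (P i) (Q i) = 1\<^sub>m (2 ^ n * 2 ^ n)"
      by (simp add: kron_mult_kron[OF c c] i[THEN pauli_ops_square] kron_one)
    show "mat_adjoint (kron (P i) (Q i)) = kron (P i) (Q i)"
      by (simp add: mat_adjoint_kron i[THEN pauli_ops_hermitian])
  qed (use comm in blast)
  moreover have "\<exists>estimate :: nat list \<Rightarrow> nat \<Rightarrow> real.
      \<forall>H U. H \<in> carrier_mat (2 ^ n) (2 ^ n) \<longrightarrow> hermitian H \<longrightarrow>
        mat_trace (H * H) = 2 ^ n \<longrightarrow> unitary (2 ^ n) U \<longrightarrow>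
        measure_pmf.prob
          (replicate_pmf N
            (basis_measurement (2 ^ n * 2 ^ n) b (vectorize (heisenberg U H))))
          {outcomes. \<forall>i<M.
            cmod (complex_of_real (estimate outcomes i)
                  - otoc n (heisenberg U H) (P i) (Q i)) \<le> \<epsilon>}
        \<ge> 1 - \<delta>"
    if b: "common_eigenbasis (2 ^ n * 2 ^ n) ?S b" for b
  proof -
    obtain est :: "nat list \<Rightarrow> nat \<Rightarrow> real" where
      "\<And>X. X \<in> carrier_mat (2 ^ n) (2 ^ n) \<Longrightarrow> mat_adjoint X = X \<Longrightarrow> mat_trace (X * X) = 2 ^ n \<Longrightarrow>
      measure_pmf.prob (replicate_pmf N (basis_measurement (2 ^ n * 2 ^ n) b (vectorize X)))
        {outcomes. \<forall>i<M. cmod (complex_of_real (est outcomes i) - otoc n X (P i) (Q i)) \<le> \<epsilon>}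
      \<ge> 1 - \<delta>"
      using otoc_estimation[of M P n Q b \<delta> \<epsilon> N] PQ b N M \<epsilon> \<delta> by auto
    \<comment> \<open>Instantiate \<open>X\<close> with \<open>heisenberg U H\<close>; the estimator
      stays the same for all \<open>H\<close> and \<open>U\<close>.\<close>
    then show ?thesis
      by (intro exI[of _ est] allI impI) (simp only: heisenberg_hermitian)
  qed
  ultimately show "\<exists>N :: nat. real N \<le> 6 * ln (real M / \<delta>) / \<epsilon>\<^sup>2 \<and>
        (\<exists>b. common_eigenbasis (2 ^ n * 2 ^ n) ?S b) \<and>
        (\<forall>b. common_eigenbasis (2 ^ n * 2 ^ n) ?S b \<longrightarrow>
          (\<exists>estimate :: nat list \<Rightarrow> nat \<Rightarrow> real.
            \<forall>H U. H \<in> carrier_mat (2 ^ n) (2 ^ n) \<longrightarrow> hermitian H \<longrightarrow>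
              mat_trace (H * H) = 2 ^ n \<longrightarrow> unitary (2 ^ n) U \<longrightarrow>
              measure_pmf.prob
                (replicate_pmf N
                  (basis_measurement (2 ^ n * 2 ^ n) b (vectorize (heisenberg U H))))
                {outcomes. \<forall>i<M.
                  cmod (complex_of_real (estimate outcomes i)
                        - otoc n (heisenberg U H) (P i) (Q i)) \<le> \<epsilon>}
              \<ge> 1 - \<delta>))"
    using N(3) by (intro exI[of _ N] conjI allI impI)
qed simp

end
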